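(* Let $n$ be a positive integer with $n\leq 8$ and let $x_1,\ldots,x_n$ be nonnegative real numbers, with $x_{n+1}=x_1$. Then $$\left(\sum_{i=1}^n x_i^3\right)^2 \geq \left(\sum_{i=1}^n x_i^2\right)\left(\sum_{i=1}^n x_i^2x_{i+1}^2\right),$$ where equality occurs if and only if $x_1=x_2=\cdots=x_n$. Moreover, the inequality does not hold in general if $n>8$: for every integer $n>8$ there exist nonnegative real numbers $x_1,\ldots,x_n$ (with $x_{n+1}=x_1$) for which it fails.
   Context: Indices are cyclic, i.e. $x_{n+1}=x_1$. *)

theory Defs
  imports Complex_Main
begin

end

theory Submission
  imports Defs
begin

text \<open>
  Write \<open>P\<close>, \<open>Q\<close>, \<open>R\<close> for the sums of \<open>x\<^sub>i\<^sup>3\<close>, \<open>x\<^sub>i\<^sup>2\<close>, \<open>x\<^sub>i\<^sup>2 x\<^sub>i\<^sub>+\<^sub>1\<^sup>2\<close>.  For a constant sequence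
  both sides agree, so everything rests on the strict inequality \<open>Q R < P\<^sup>2\<close> for non-constant
  sequences.

  The case of eight variables implies all shorter ones.  With \<open>t = P / Q\<close> the numbers
  \<open>x\<^sub>i\<^sup>2 (x\<^sub>i - t)\<close> sum to zero, so somewhere along the cycle the sequence crosses the level \<open>t\<close>.
  Inserting a new entry \<open>t\<close> there keeps the quotient \<open>P / Q\<close>, and the inequality for the
  longer sequence implies the one for the original (\<open>strict_cyclic_ineq_pred\<close>).

  For eight variables put \<open>a\<^sub>i = x\<^sub>i\<^sup>2\<close>.  The defect in the Cauchy-Schwarz inequality
  \<open>P\<^sup>2 \<le> Q \<Sum> x\<^sub>i\<^sup>4\<close> is a sum over pairs of \<open>x\<^sup>2 y\<^sup>2 (x - y)\<^sup>2\<close>, and each such term is at most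
  \<open>(x\<^sup>2 + y\<^sup>2) (x\<^sup>2 - y\<^sup>2)\<^sup>2 / 8\<close>, strictly so when \<open>x \<noteq> y\<close>
  (\<open>pair_defect_less\<close>).  This replaces the sextic problem by a cubic one in the \<open>a\<^sub>i\<close>
  (\<open>octagon_cubic_ineq\<close>), which amounts to
  \<open>\<Sum> a\<^sub>i (4 E - \<Sum> (a\<^sub>j - a\<^sub>i)\<^sup>2) \<ge> 0\<close> with outer sum over \<open>i\<close>, inner sum over \<open>j\<close> and
  \<open>E = \<Sum> (a\<^sub>i - a\<^sub>i\<^sub>+\<^sub>1)\<^sup>2\<close>, a weighted
  discrete Wirtinger inequality on the octagon.  The quadratic factors can be changed, without
  changing the weighted sum, into one positive semidefinite form and its rotations.

  The bound eight comes from the second variation at a constant sequence: for \<open>x = 1 + \<epsilon> y\<close> with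
  \<open>\<Sum> y\<^sub>i = 0\<close> the difference \<open>P\<^sup>2 - Q R\<close> starts with
  \<open>n \<epsilon>\<^sup>2 (3 \<Sum> y\<^sub>i\<^sup>2 - 4 \<Sum> y\<^sub>i y\<^sub>i\<^sub>+\<^sub>1)\<close>, which the first Fourier mode makes negative exactly when
  \<open>cos (2 \<pi> / n) > 3 / 4\<close>, that is, from \<open>n = 9\<close> on.  A rational version of that mode for
  \<open>n = 9\<close>, padded with further copies of its smallest value, refutes all larger \<open>n\<close>.
\<close>

section \<open>Inserting an entry into a cyclic sequence\<close>

definition insert_at :: "nat \<Rightarrow> 'a \<Rightarrow> (nat \<Rightarrow> 'a) \<Rightarrow> nat \<Rightarrow> 'a" where
  "insert_at k t x j = (if j \<le> k then x j else if j = k + 1 then t else x (j - 1))"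

lemma sum_insert_at:
  fixes g :: "'a \<Rightarrow> 'b::comm_monoid_add"
  assumes "k \<le> n"
  shows "(\<Sum>j=1..n+1. g (insert_at k t x j)) = (\<Sum>j=1..n. g (x j)) + g t"
  using assms
proof (induction n rule: dec_induct)
  case base
  have "(\<Sum>j=1..k. g (insert_at k t x j)) = (\<Sum>j=1..k. g (x j))"
    by (rule sum.cong) (auto simp: insert_at_def)
  then show ?case by (simp add: insert_at_def)
next
  case (step n)
  then show ?case by (simp add: insert_at_def ac_simps)
qed

lemma sum_edges_insert_at:
  fixes g :: "'a \<Rightarrow> 'a \<Rightarrow> 'b::ab_group_add"
  assumes "1 \<le> k" "k \<le> n"
  shows "(\<Sum>j=1..n+1. g (insert_at k t x j) (insert_at k t x (j + 1))) =
    (\<Sum>j=1..n. g (x j) (x (j + 1))) - g (x k) (x (k + 1)) + g (x k) t + g t (x (k + 1))"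
  using assms(2)
proof (induction n rule: dec_induct)
  case base
  obtain l where k: "k = Suc l" using assms(1) by (cases k) auto
  have "(\<Sum>j=1..l. g (insert_at k t x j) (insert_at k t x (j + 1))) = (\<Sum>j=1..l. g (x j) (x (j + 1)))"
    by (rule sum.cong) (auto simp: insert_at_def k)
  then show ?case by (simp add: insert_at_def k algebra_simps)
next
  case (step n)
  then show ?case by (simp add: insert_at_def algebra_simps)
qed

section \<open>Reduction to longer cycles\<close>

definition strict_cyclic_ineq :: "nat \<Rightarrow> bool" where
  "strict_cyclic_ineq n \<longleftrightarrow> (\<forall>x::nat \<Rightarrow> real.
     (\<forall>i\<in>{1..n}. 0 \<le> x i) \<longrightarrow> x (n + 1) = x 1 \<longrightarrow> (\<exists>i\<in>{1..n}. \<exists>j\<in>{1..n}. x i \<noteq> x j) \<longrightarrow>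
     (\<Sum>i=1..n. (x i)\<^sup>2) * (\<Sum>i=1..n. (x i)\<^sup>2 * (x (i + 1))\<^sup>2) < (\<Sum>i=1..n. x i ^ 3)\<^sup>2)"

text \<open>
  If no edge crosses the level \<open>t\<close>, all entries lie strictly on one side of it, so all terms of
  the balance \<open>\<Sum> x\<^sub>i\<^sup>2 (x\<^sub>i - t) = 0\<close> have the same sign and vanish.
\<close>

lemma balanced_level_is_crossed:
  fixes x :: "nat \<Rightarrow> real"
  assumes bal: "(\<Sum>i=1..n. (x i)\<^sup>2 * (x i - t)) = 0"
    and nonconst: "\<exists>i\<in>{1..n}. \<exists>j\<in>{1..n}. x i \<noteq> x j"
  obtains k where "k \<in> {1..n}" "(x k - t) * (x (k + 1) - t) \<le> 0"
proof (rule ccontr)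
  note crossing = that
  assume "\<not> thesis"
  then have same: "(x k - t) * (x (k + 1) - t) > 0" if "k \<in> {1..n}" for k
    using crossing[OF that] by linarith
  have side: "(x j - t) * (x 1 - t) > 0" if "1 \<le> j" "j \<le> n" for j
    using that
  proof (induction j rule: dec_induct)
    case base
    have "x 1 - t \<noteq> 0" using same[of 1] that by auto
    then show ?case by (simp add: zero_less_mult_iff) linarith
  next
    case (step m)
    then have "(x m - t) * (x 1 - t) > 0" "(x m - t) * (x (m + 1) - t) > 0"
      using same[of m] by auto
    then show ?case by (auto simp: zero_less_mult_iff)
  qed
  have "(x 1 - t) * ((x i)\<^sup>2 * (x i - t)) \<ge> 0" if "i \<in> {1..n}" for i
  proof -
    have "0 \<le> (x i)\<^sup>2 * ((x i - t) * (x 1 - t))"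
      using side[of i] that by (intro mult_nonneg_nonneg[OF zero_le_power2]) auto
    then show ?thesis by (simp only: mult_ac)
  qed
  moreover have "(\<Sum>i=1..n. (x 1 - t) * ((x i)\<^sup>2 * (x i - t))) = 0"
    unfolding sum_distrib_left[symmetric] bal by simp
  ultimately have "\<forall>i\<in>{1..n}. (x 1 - t) * ((x i)\<^sup>2 * (x i - t)) = 0"
    using sum_nonneg_eq_0_iff[of "{1..n}" "\<lambda>i. (x 1 - t) * ((x i)\<^sup>2 * (x i - t))"] by auto
  then have "\<forall>i\<in>{1..n}. x i = 0" using side by force
  then show False using nonconst by auto
qed

text \<open>
  Let \<open>P'\<close>, \<open>Q'\<close>, \<open>R'\<close> belong to the sequence with \<open>t = P / Q\<close> inserted between the entries \<open>u\<close>
  and \<open>v\<close>.  Then \<open>P' = t Q'\<close>, so the longer inequality says \<open>R' < t\<^sup>2 Q'\<close>, and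
  \<open>t\<^sup>2 Q - R\<close> exceeds \<open>t\<^sup>2 Q' - R'\<close> by \<open>- (u\<^sup>2 - t\<^sup>2) (v\<^sup>2 - t\<^sup>2) \<ge> 0\<close>.
\<close>

lemma strict_cyclic_ineq_pred:
  assumes longer: "strict_cyclic_ineq (n + 1)"
  shows "strict_cyclic_ineq n"
  unfolding strict_cyclic_ineq_def
proof (intro allI impI)
  fix x :: "nat \<Rightarrow> real"
  assume nonneg: "\<forall>i\<in>{1..n}. 0 \<le> x i" and cyc: "x (n + 1) = x 1"
    and nonconst: "\<exists>i\<in>{1..n}. \<exists>j\<in>{1..n}. x i \<noteq> x j"
  define P where "P = (\<Sum>i=1..n. x i ^ 3)"
  define Q where "Q = (\<Sum>i=1..n. (x i)\<^sup>2)"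
  define R where "R = (\<Sum>i=1..n. (x i)\<^sup>2 * (x (i + 1))\<^sup>2)"
  define t where "t = P / Q"
  have "Q \<noteq> 0"
  proof
    assume "Q = 0"
    then have "\<forall>i\<in>{1..n}. x i = 0" by (simp add: Q_def sum_nonneg_eq_0_iff)
    then show False using nonconst by auto
  qed
  moreover have "Q \<ge> 0" by (simp add: Q_def sum_nonneg)
  ultimately have Q: "Q > 0" by simp
  have P: "P = t * Q" using Q by (simp add: t_def)
  have t: "t \<ge> 0" unfolding t_def P_def using Q nonneg by (intro divide_nonneg_pos sum_nonneg) auto
  have "(\<Sum>i=1..n. (x i)\<^sup>2 * (x i - t)) = P - t * Q"
    by (simp add: P_def Q_def right_diff_distrib sum_subtractf sum_distrib_left
        power2_eq_square power3_eq_cube mult_ac)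
  then obtain k where k: "k \<in> {1..n}" and cross: "(x k - t) * (x (k + 1) - t) \<le> 0"
    using balanced_level_is_crossed[where n = n and x = x and t = t] nonconst P by auto
  let ?y = "insert_at k t x"
  have P': "(\<Sum>j=1..n+1. ?y j ^ 3) = t * (Q + t\<^sup>2)"
    using sum_insert_at[of k n "\<lambda>z. z ^ 3" t x] k P
    by (simp add: P_def algebra_simps power2_eq_square power3_eq_cube)
  have Q': "(\<Sum>j=1..n+1. (?y j)\<^sup>2) = Q + t\<^sup>2"
    using sum_insert_at[of k n "\<lambda>z. z\<^sup>2" t x] k by (simp add: Q_def)
  have R': "(\<Sum>j=1..n+1. (?y j)\<^sup>2 * (?y (j + 1))\<^sup>2) =
      R - (x k)\<^sup>2 * (x (k + 1))\<^sup>2 + (x k)\<^sup>2 * t\<^sup>2 + t\<^sup>2 * (x (k + 1))\<^sup>2"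
    using sum_edges_insert_at[of k n "\<lambda>u v. u\<^sup>2 * v\<^sup>2" t x] k by (simp add: R_def)
  have "\<exists>i\<in>{1..n+1}. \<exists>j\<in>{1..n+1}. ?y i \<noteq> ?y j"
  proof -
    obtain i j where ij: "i \<in> {1..n}" "j \<in> {1..n}" "x i \<noteq> x j" using nonconst by blast
    have shift: "\<exists>j\<in>{1..n+1}. ?y j = x i" if "i \<in> {1..n}" for i
    proof (cases "i \<le> k")
      case True
      then show ?thesis using that by (intro bexI[of _ i]) (auto simp: insert_at_def)
    next
      case False
      then show ?thesis using that by (intro bexI[of _ "i + 1"]) (auto simp: insert_at_def)
    qed
    show ?thesis using shift[OF ij(1)] shift[OF ij(2)] ij(3) by metis
  qed
  moreover have "\<forall>i\<in>{1..n+1}. 0 \<le> ?y i" using nonneg t k by (force simp: insert_at_def)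
  moreover have "?y (n + 1 + 1) = ?y 1" using k cyc by (auto simp: insert_at_def)
  ultimately have "(\<Sum>j=1..n+1. (?y j)\<^sup>2) * (\<Sum>j=1..n+1. (?y j)\<^sup>2 * (?y (j + 1))\<^sup>2)
      < (\<Sum>j=1..n+1. ?y j ^ 3)\<^sup>2"
    using longer unfolding strict_cyclic_ineq_def by blast
  then have "(Q + t\<^sup>2) * (R - (x k)\<^sup>2 * (x (k + 1))\<^sup>2 + (x k)\<^sup>2 * t\<^sup>2 + t\<^sup>2 * (x (k + 1))\<^sup>2)
      < (Q + t\<^sup>2) * (t\<^sup>2 * (Q + t\<^sup>2))"
    unfolding P' Q' R' by (simp add: power2_eq_square mult_ac)
  moreover have "Q + t\<^sup>2 > 0" using Q by (simp add: add_pos_nonneg)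
  ultimately have "R - (x k)\<^sup>2 * (x (k + 1))\<^sup>2 + (x k)\<^sup>2 * t\<^sup>2 + t\<^sup>2 * (x (k + 1))\<^sup>2
      < t\<^sup>2 * (Q + t\<^sup>2)"
    by (simp only: mult_less_cancel_left_pos)
  then have "R < t\<^sup>2 * Q + ((x k)\<^sup>2 - t\<^sup>2) * ((x (k + 1))\<^sup>2 - t\<^sup>2)"
    by (simp add: algebra_simps)
  moreover have "((x k)\<^sup>2 - t\<^sup>2) * ((x (k + 1))\<^sup>2 - t\<^sup>2) \<le> 0"
  proof -
    have "x k \<ge> 0" using nonneg k by auto
    moreover have "x (k + 1) \<ge> 0"
    proof (cases "k = n")
      case True
      then show ?thesis using nonneg k cyc by force
    qed (use nonneg k in auto)
    ultimately have "(x k + t) * (x (k + 1) + t) \<ge> 0" using t by simp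
    then have "((x k - t) * (x (k + 1) - t)) * ((x k + t) * (x (k + 1) + t)) \<le> 0"
      using cross by (rule mult_nonpos_nonneg[rotated])
    then show ?thesis by (simp add: power2_eq_square algebra_simps)
  qed
  ultimately have "R < t\<^sup>2 * Q" by simp
  then have "Q * R < Q * (t\<^sup>2 * Q)" using Q by simp
  also have "\<dots> = P\<^sup>2" by (simp add: P power2_eq_square)
  finally show "(\<Sum>i=1..n. (x i)\<^sup>2) * (\<Sum>i=1..n. (x i)\<^sup>2 * (x (i + 1))\<^sup>2) < (\<Sum>i=1..n. x i ^ 3)\<^sup>2"
    by (simp add: P_def Q_def R_def)
qed

section \<open>From degree six to degree three\<close>

lemma pair_defect_less:
  fixes x y :: real
  assumes "0 \<le> x" "0 \<le> y" "x \<noteq> y"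
  shows "8 * (x\<^sup>2 * y\<^sup>2 * (x - y)\<^sup>2) < (x\<^sup>2 + y\<^sup>2) * (x\<^sup>2 - y\<^sup>2)\<^sup>2"
proof -
  have "8 * (x\<^sup>2 * y\<^sup>2) < (x\<^sup>2 + y\<^sup>2) * (x + y)\<^sup>2"
  proof -
    have "(x\<^sup>2 + y\<^sup>2) * (x + y)\<^sup>2 - 8 * (x\<^sup>2 * y\<^sup>2) = (x\<^sup>2 - y\<^sup>2)\<^sup>2 + 2 * (x * y) * (x - y)\<^sup>2"
      by algebra
    moreover have "x\<^sup>2 \<noteq> y\<^sup>2" using assms by simp
    then have "(x\<^sup>2 - y\<^sup>2)\<^sup>2 > 0" by simp
    moreover have "2 * (x * y) * (x - y)\<^sup>2 \<ge> 0" using assms by simp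
    ultimately show ?thesis by linarith
  qed
  then have "8 * (x\<^sup>2 * y\<^sup>2) * (x - y)\<^sup>2 < (x\<^sup>2 + y\<^sup>2) * (x + y)\<^sup>2 * (x - y)\<^sup>2"
    using assms by simp
  also have "\<dots> = (x\<^sup>2 + y\<^sup>2) * (x\<^sup>2 - y\<^sup>2)\<^sup>2" by algebra
  finally show ?thesis by (simp add: mult.assoc)
qed

text \<open>
  Both sides are half a sum over ordered pairs, of \<open>8 x\<^sup>2 y\<^sup>2 (x - y)\<^sup>2\<close> on the left and of
  \<open>(x\<^sup>2 + y\<^sup>2) (x\<^sup>2 - y\<^sup>2)\<^sup>2\<close> on the right.
\<close>

lemma cauchy_defect_less:
  fixes x :: "'a \<Rightarrow> real"
  assumes fin: "finite A" and nonneg: "\<And>i. i \<in> A \<Longrightarrow> 0 \<le> x i"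
    and nonconst: "i \<in> A" "j \<in> A" "x i \<noteq> x j"
  shows "8 * ((\<Sum>i\<in>A. (x i)\<^sup>2) * (\<Sum>i\<in>A. x i ^ 4) - (\<Sum>i\<in>A. x i ^ 3)\<^sup>2)
    < card A * (\<Sum>i\<in>A. x i ^ 6) - (\<Sum>i\<in>A. (x i)\<^sup>2) * (\<Sum>i\<in>A. x i ^ 4)"
proof -
  let ?L = "\<lambda>(u::real) v. 8 * (u\<^sup>2 * v\<^sup>2 * (u - v)\<^sup>2)"
  let ?R = "\<lambda>(u::real) v. (u\<^sup>2 + v\<^sup>2) * (u\<^sup>2 - v\<^sup>2)\<^sup>2"
  have le: "?L (x i) (x j) \<le> ?R (x i) (x j)" if "i \<in> A" "j \<in> A" for i j
    using pair_defect_less[of "x i" "x j"] nonneg that by (cases "x i = x j") auto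
  have less: "(\<Sum>i\<in>A. \<Sum>j\<in>A. ?L (x i) (x j)) < (\<Sum>i\<in>A. \<Sum>j\<in>A. ?R (x i) (x j))"
  proof (rule sum_strict_mono_ex1[OF fin])
    show "\<forall>i\<in>A. (\<Sum>j\<in>A. ?L (x i) (x j)) \<le> (\<Sum>j\<in>A. ?R (x i) (x j))"
      using le by (auto intro!: sum_mono)
    have "(\<Sum>j\<in>A. ?L (x i) (x j)) < (\<Sum>j\<in>A. ?R (x i) (x j))"
      using le nonconst pair_defect_less[of "x i" "x j"] nonneg
      by (intro sum_strict_mono_ex1[OF fin]) auto
    then show "\<exists>i\<in>A. (\<Sum>j\<in>A. ?L (x i) (x j)) < (\<Sum>j\<in>A. ?R (x i) (x j))"
      using nonconst(1) by blast
  qed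
  have L: "(\<Sum>i\<in>A. \<Sum>j\<in>A. ?L (x i) (x j)) =
      16 * ((\<Sum>i\<in>A. (x i)\<^sup>2) * (\<Sum>i\<in>A. x i ^ 4) - (\<Sum>i\<in>A. x i ^ 3)\<^sup>2)"
  proof -
    have "?L u v = 8 * (u ^ 4 * v\<^sup>2) - 16 * (u ^ 3 * v ^ 3) + 8 * (u\<^sup>2 * v ^ 4)" for u v
      by algebra
    then have "(\<Sum>i\<in>A. \<Sum>j\<in>A. ?L (x i) (x j)) =
      8 * ((\<Sum>i\<in>A. x i ^ 4) * (\<Sum>j\<in>A. (x j)\<^sup>2)) - 16 * ((\<Sum>i\<in>A. x i ^ 3) * (\<Sum>j\<in>A. x j ^ 3))
      + 8 * ((\<Sum>i\<in>A. (x i)\<^sup>2) * (\<Sum>j\<in>A. x j ^ 4))"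
      by (simp add: sum.distrib sum_subtractf sum_distrib_left[symmetric] sum_product)
    then show ?thesis by (simp add: power2_eq_square algebra_simps)
  qed
  have R: "(\<Sum>i\<in>A. \<Sum>j\<in>A. ?R (x i) (x j)) =
      2 * (card A * (\<Sum>i\<in>A. x i ^ 6) - (\<Sum>i\<in>A. (x i)\<^sup>2) * (\<Sum>i\<in>A. x i ^ 4))"
  proof -
    have "?R u v = u ^ 6 - u ^ 4 * v\<^sup>2 - u\<^sup>2 * v ^ 4 + v ^ 6" for u v
      by algebra
    then have "(\<Sum>i\<in>A. \<Sum>j\<in>A. ?R (x i) (x j)) =
      card A * (\<Sum>i\<in>A. x i ^ 6) - (\<Sum>i\<in>A. x i ^ 4) * (\<Sum>j\<in>A. (x j)\<^sup>2)
      - (\<Sum>i\<in>A. (x i)\<^sup>2) * (\<Sum>j\<in>A. x j ^ 4) + card A * (\<Sum>j\<in>A. x j ^ 6)"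
      by (simp add: sum.distrib sum_subtractf sum_distrib_left[symmetric] sum_product)
    then show ?thesis by (simp add: algebra_simps)
  qed
  show ?thesis using less unfolding L R by (simp add: algebra_simps)
qed

section \<open>A weighted Wirtinger inequality on the octagon\<close>

text \<open>
  The form belongs to the vertex with value \<open>a0\<close> of an octagon with values \<open>a0\<close>, \<dots>, \<open>a7\<close>.  It
  is split into combinations of the differences \<open>p1\<close>, \<dots>, \<open>p4\<close>, which are even under the
  reflection fixing that vertex, and of the odd differences \<open>m1\<close>, \<open>m2\<close>, \<open>m3\<close>.
\<close>

definition octagon_form ::
    "real \<Rightarrow> real \<Rightarrow> real \<Rightarrow> real \<Rightarrow> real \<Rightarrow> real \<Rightarrow> real \<Rightarrow> real \<Rightarrow> real" where
  "octagon_form a0 a1 a2 a3 a4 a5 a6 a7 =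
    (let p1 = a1 + a7 - 2 * a0; p2 = a2 + a6 - 2 * a0; p3 = a3 + a5 - 2 * a0; p4 = a4 - a0;
         m1 = a1 - a7; m2 = a2 - a6; m3 = a3 - a5
     in 4/3 * (p1 - 21/16 * p2 + p3 - 5/8 * p4)\<^sup>2 + 5/3 * (p3 - 1/20 * p2 - 9/5 * p4)\<^sup>2
        + 43/80 * (p4 - 106/129 * p2)\<^sup>2 + 67/24768 * p2\<^sup>2
        + 5/3 * (m1 - 5/4 * m2 + 2/5 * m3)\<^sup>2 + 5/3 * (m2 - 11/5 * m3)\<^sup>2)"

text \<open>The factor \<open>48\<close> clears the denominators of the coefficients.\<close>

lemma octagon_form_expand:
  "48 * octagon_form a0 a1 a2 a3 a4 a5 a6 a7 =
      48 * a0\<^sup>2 - 96 * a0 * a1 + 99 * a0 * a2 - 112 * a0 * a3 + 122 * a0 * a4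
       - 112 * a0 * a5 + 99 * a0 * a6 - 96 * a0 * a7 + 144 * a1\<^sup>2 - 368 * a1 * a2
       + 192 * a1 * a3 - 80 * a1 * a4 + 64 * a1 * a5 + 32 * a1 * a6 - 32 * a1 * a7
       + 333 * a2\<^sup>2 - 608 * a2 * a3 + 77 * a2 * a4 + 256 * a2 * a5 - 154 * a2 * a6
       + 32 * a2 * a7 + 544 * a3\<^sup>2 - 368 * a3 * a4 - 512 * a3 * a5 + 256 * a3 * a6
       + 64 * a3 * a7 + 310 * a4\<^sup>2 - 368 * a4 * a5 + 77 * a4 * a6 - 80 * a4 * a7
       + 544 * a5\<^sup>2 - 608 * a5 * a6 + 192 * a5 * a7 + 333 * a6\<^sup>2 - 368 * a6 * a7
       + 144 * a7\<^sup>2"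
  unfolding octagon_form_def Let_def by algebra

lemma octagon_form_nonneg: "octagon_form a0 a1 a2 a3 a4 a5 a6 a7 \<ge> 0"
  by (simp add: octagon_form_def Let_def)

text \<open>
  The natural quadratic factor \<open>4 E - \<Sum> (a\<^sub>j - a\<^sub>i)\<^sup>2\<close> of \<open>a\<^sub>i\<close> is indefinite.  A monomial
  \<open>a\<^sub>i a\<^sub>j a\<^sub>k\<close> can however be booked with any of its three indices, which leaves seven free
  parameters for a form that is symmetric under reflection and vanishes on constants; semidefinite
  programming, with rounding to small fractions, yields \<open>octagon_form\<close>.
\<close>

lemma octagon_cubic_ineq:
  fixes a0 a1 a2 a3 a4 a5 a6 a7 :: real
  assumes "0 \<le> a0" "0 \<le> a1" "0 \<le> a2" "0 \<le> a3" "0 \<le> a4" "0 \<le> a5" "0 \<le> a6" "0 \<le> a7"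
  shows "8 * ((a0 + a1 + a2 + a3 + a4 + a5 + a6 + a7) *
        (a0*a1 + a1*a2 + a2*a3 + a3*a4 + a4*a5 + a5*a6 + a6*a7 + a7*a0))
    \<le> 9 * ((a0 + a1 + a2 + a3 + a4 + a5 + a6 + a7) *
        (a0\<^sup>2 + a1\<^sup>2 + a2\<^sup>2 + a3\<^sup>2 + a4\<^sup>2 + a5\<^sup>2 + a6\<^sup>2 + a7\<^sup>2))
      - 8 * (a0^3 + a1^3 + a2^3 + a3^3 + a4^3 + a5^3 + a6^3 + a7^3)"
proof -
  have scale: "v \<le> u" if "0 \<le> 48 * (u - v)" for u v :: real
    using that by simp
  have "0 \<le> a0 * (48 * octagon_form a0 a1 a2 a3 a4 a5 a6 a7)
      + a1 * (48 * octagon_form a1 a2 a3 a4 a5 a6 a7 a0)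
      + a2 * (48 * octagon_form a2 a3 a4 a5 a6 a7 a0 a1)
      + a3 * (48 * octagon_form a3 a4 a5 a6 a7 a0 a1 a2)
      + a4 * (48 * octagon_form a4 a5 a6 a7 a0 a1 a2 a3)
      + a5 * (48 * octagon_form a5 a6 a7 a0 a1 a2 a3 a4)
      + a6 * (48 * octagon_form a6 a7 a0 a1 a2 a3 a4 a5)
      + a7 * (48 * octagon_form a7 a0 a1 a2 a3 a4 a5 a6)"
    using assms by (intro add_nonneg_nonneg mult_nonneg_nonneg octagon_form_nonneg) simp_all
  also have "\<dots> = 48 * (9 * ((a0 + a1 + a2 + a3 + a4 + a5 + a6 + a7) *
        (a0\<^sup>2 + a1\<^sup>2 + a2\<^sup>2 + a3\<^sup>2 + a4\<^sup>2 + a5\<^sup>2 + a6\<^sup>2 + a7\<^sup>2))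
      - 8 * (a0^3 + a1^3 + a2^3 + a3^3 + a4^3 + a5^3 + a6^3 + a7^3)
      - 8 * ((a0 + a1 + a2 + a3 + a4 + a5 + a6 + a7) *
        (a0*a1 + a1*a2 + a2*a3 + a3*a4 + a4*a5 + a5*a6 + a6*a7 + a7*a0)))"
    unfolding octagon_form_expand by algebra
  finally show ?thesis by (rule scale)
qed

lemma strict_cyclic_ineq_8: "strict_cyclic_ineq 8"
  unfolding strict_cyclic_ineq_def
proof (intro allI impI)
  fix x :: "nat \<Rightarrow> real"
  assume nonneg: "\<forall>i\<in>{1..8}. 0 \<le> x i" and cyc: "x (8 + 1) = x 1"
    and nonconst: "\<exists>i\<in>{1..8}. \<exists>j\<in>{1..8}. x i \<noteq> x j"
  have sum8: "(\<Sum>i=1..8. g i) = g 1 + g 2 + g 3 + g 4 + g 5 + g 6 + g 7 + g 8"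
    for g :: "nat \<Rightarrow> real"
    by (simp add: eval_nat_numeral)
  have pow: "(u\<^sup>2)\<^sup>2 = u ^ 4" "(u\<^sup>2) ^ 3 = u ^ 6" for u :: real
    by (simp_all flip: power_mult)
  have "8 * ((\<Sum>i=1..8. (x i)\<^sup>2) * (\<Sum>i=1..8. (x i)\<^sup>2 * (x (i + 1))\<^sup>2))
    \<le> 9 * ((\<Sum>i=1..8. (x i)\<^sup>2) * (\<Sum>i=1..8. x i ^ 4)) - 8 * (\<Sum>i=1..8. x i ^ 6)"
    using octagon_cubic_ineq[of "(x 1)\<^sup>2" "(x 2)\<^sup>2" "(x 3)\<^sup>2" "(x 4)\<^sup>2" "(x 5)\<^sup>2" "(x 6)\<^sup>2" "(x 7)\<^sup>2"
        "(x 8)\<^sup>2"] cyc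
    unfolding sum8 pow by (simp del: One_nat_def)
  moreover have "8 * ((\<Sum>i=1..8. (x i)\<^sup>2) * (\<Sum>i=1..8. x i ^ 4) - (\<Sum>i=1..8. x i ^ 3)\<^sup>2)
    < 8 * (\<Sum>i=1..8. x i ^ 6) - (\<Sum>i=1..8. (x i)\<^sup>2) * (\<Sum>i=1..8. x i ^ 4)"
    using nonconst cauchy_defect_less[of "{1..8::nat}" x] nonneg by fastforce
  ultimately show "(\<Sum>i=1..8. (x i)\<^sup>2) * (\<Sum>i=1..8. (x i)\<^sup>2 * (x (i + 1))\<^sup>2) < (\<Sum>i=1..8. x i ^ 3)\<^sup>2"
    by argo
qed

lemma strict_cyclic_ineq_le_8:
  assumes "n \<le> 8"
  shows "strict_cyclic_ineq n"
  using assms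
proof (induction n rule: inc_induct)
  case base
  show ?case by (rule strict_cyclic_ineq_8)
next
  case (step n)
  then show ?case using strict_cyclic_ineq_pred[of n] by simp
qed

section \<open>Failure from nine variables on\<close>

text \<open>
  For \<open>1 \<le> i \<le> 9\<close> the excess over the base value \<open>15\<close> approximates a multiple of
  \<open>1 - cos (2 \<pi> (i - 1) / 9)\<close>.  Since \<open>15\<^sup>3 15\<^sup>3 = 15\<^sup>2 15\<^sup>4\<close>, the difference of the two sides
  is affine in \<open>n \<ge> 9\<close>; its slope is negative, as is its value at \<open>9\<close>.
\<close>

definition bump :: "nat \<Rightarrow> real" where
  "bump i = (if i = 2 \<or> i = 9 then 16 else if i = 3 \<or> i = 8 then 18 else
     if i = 4 \<or> i = 7 then 20 else if i = 5 \<or> i = 6 then 21 else 15)"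

lemma sum_bump:
  assumes base: "g 15 15 = c"
    and nine: "(\<Sum>i=1..9. g (bump i) (bump (i + 1))) = 9 * c + (d::real)"
    and "9 \<le> n"
  shows "(\<Sum>i=1..n. g (bump i) (bump (i + 1))) = n * c + d"
  using assms(3)
proof (induction n rule: dec_induct)
  case base
  then show ?case using nine by simp
next
  case (step n)
  then show ?case using base by (simp add: bump_def algebra_simps)
qed

lemma cyclic_ineq_fails:
  assumes "8 < n"
  shows "(\<Sum>i=1..n. bump i ^ 3)\<^sup>2 <
    (\<Sum>i=1..n. (bump i)\<^sup>2) * (\<Sum>i=1..n. (bump i)\<^sup>2 * (bump (i + 1))\<^sup>2)"
proof -
  have n: "9 \<le> n" using assms by simp
  have sum9: "(\<Sum>i=1..9. g i) = g 1 + g 2 + g 3 + g 4 + g 5 + g 6 + g 7 + g 8 + g 9"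
    for g :: "nat \<Rightarrow> real"
    by (simp add: eval_nat_numeral)
  have P: "(\<Sum>i=1..n. bump i ^ 3) = real n * 3375 + 27378"
    by (rule sum_bump[where g = "\<lambda>u v. u ^ 3", OF _ _ n]) (simp_all only: sum9, simp_all add: bump_def)
  have Q: "(\<Sum>i=1..n. (bump i)\<^sup>2) = real n * 225 + 1042"
    by (rule sum_bump[where g = "\<lambda>u v. u\<^sup>2", OF _ _ n]) (simp_all only: sum9, simp_all add: bump_def)
  have R: "(\<Sum>i=1..n. (bump i)\<^sup>2 * (bump (i + 1))\<^sup>2) = real n * 50625 + 631944"
    by (rule sum_bump[where g = "\<lambda>u v. u\<^sup>2 * v\<^sup>2", OF _ _ n]) (simp_all only: sum9, simp_all add: bump_def)
  show ?thesis unfolding P Q R using n by (simp add: power2_eq_square algebra_simps)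
qed

section \<open>The range of validity and the equality case\<close>

theorem theorem2:
  shows "(\<forall>(n::nat) (x::nat \<Rightarrow> real).
            1 \<le> n \<and> n \<le> 8 \<and> (\<forall>i\<in>{1..n}. 0 \<le> x i) \<and> x (n + 1) = x 1 \<longrightarrow>
              (\<Sum>i=1..n. x i ^ 3)\<^sup>2 \<ge> (\<Sum>i=1..n. (x i)\<^sup>2) * (\<Sum>i=1..n. (x i)\<^sup>2 * (x (i + 1))\<^sup>2) \<and>
              ((\<Sum>i=1..n. x i ^ 3)\<^sup>2 = (\<Sum>i=1..n. (x i)\<^sup>2) * (\<Sum>i=1..n. (x i)\<^sup>2 * (x (i + 1))\<^sup>2)
                 \<longleftrightarrow> (\<forall>i\<in>{1..n}. \<forall>j\<in>{1..n}. x i = x j)))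
       \<and> (\<forall>n::nat. n > 8 \<longrightarrow>
            (\<exists>x::nat \<Rightarrow> real. (\<forall>i\<in>{1..n}. 0 \<le> x i) \<and> x (n + 1) = x 1 \<and>
              \<not> ((\<Sum>i=1..n. x i ^ 3)\<^sup>2 \<ge> (\<Sum>i=1..n. (x i)\<^sup>2) * (\<Sum>i=1..n. (x i)\<^sup>2 * (x (i + 1))\<^sup>2))))"
proof (intro conjI allI impI)
  fix n :: nat and x :: "nat \<Rightarrow> real"
  assume asm: "1 \<le> n \<and> n \<le> 8 \<and> (\<forall>i\<in>{1..n}. 0 \<le> x i) \<and> x (n + 1) = x 1"
  let ?P = "\<Sum>i=1..n. x i ^ 3" and ?Q = "\<Sum>i=1..n. (x i)\<^sup>2"
  let ?R = "\<Sum>i=1..n. (x i)\<^sup>2 * (x (i + 1))\<^sup>2"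
  let ?const = "\<forall>i\<in>{1..n}. \<forall>j\<in>{1..n}. x i = x j"
  have const: "?P\<^sup>2 = ?Q * ?R" if ?const
  proof -
    define c where "c = x 1"
    have c: "x i = c" if "i \<in> {1..n+1}" for i
    proof (cases "i = n + 1")
      case True
      then show ?thesis using asm by (simp add: c_def)
    next
      case False
      then have "i \<in> {1..n}" "1 \<in> {1..n}" using that asm by auto
      then show ?thesis using \<open>?const\<close> unfolding c_def by blast
    qed
    have "?P = n * c ^ 3" "?Q = n * c\<^sup>2" using c by simp_all
    moreover have "?R = (\<Sum>i=1..n. c\<^sup>2 * c\<^sup>2)" using c by (intro sum.cong refl) simp
    then have "?R = n * (c\<^sup>2 * c\<^sup>2)" by simp
    ultimately show ?thesis by algebra
  qed
  have strict: "?Q * ?R < ?P\<^sup>2" if "\<not> ?const"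
    using strict_cyclic_ineq_le_8[of n] asm that unfolding strict_cyclic_ineq_def by blast
  have equality_case: "q \<le> p \<and> (p = q \<longleftrightarrow> C)" if "C \<Longrightarrow> p = q" "\<not> C \<Longrightarrow> q < p"
    for p q :: real and C
    using that by (cases C) auto
  show "?Q * ?R \<le> ?P\<^sup>2"
    by (rule equality_case[OF const strict, THEN conjunct1])
  show "?P\<^sup>2 = ?Q * ?R \<longleftrightarrow> ?const"
    by (rule equality_case[OF const strict, THEN conjunct2])
next
  fix n :: nat
  assume "n > 8"
  moreover from this have "bump (n + 1) = bump 1" by (simp add: bump_def)
  moreover have "\<forall>i\<in>{1..n}. 0 \<le> bump i" by (simp add: bump_def)
  ultimately show "\<exists>x::nat \<Rightarrow> real. (\<forall>i\<in>{1..n}. 0 \<le> x i) \<and> x (n + 1) = x 1 \<and>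
      \<not> ((\<Sum>i=1..n. x i ^ 3)\<^sup>2 \<ge> (\<Sum>i=1..n. (x i)\<^sup>2) * (\<Sum>i=1..n. (x i)\<^sup>2 * (x (i + 1))\<^sup>2))"
    using cyclic_ineq_fails[of n] not_le by blast
qed

end
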